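(* Let $f(t)=\sum_{i\ge 1}f_i\frac{t^i}{i!}\in\mathbb{R}[[t]]$ with $f_1\ne 0$, let $\lambda,q$ be indeterminates, let $g(t)=\exp(\lambda f(t))$, and let $r\ge 1$ be an integer. If $1/\bar f'(t)$ is a PF$_r$ function, then: (i) the Hankel matrices $[S_{i+j}(f,g;q)]_{i,j\ge 0}$ and $[S^*_{i+j}(f,g;q)]_{i,j\ge 0}$ are $(\lambda,q)$-TP$_r$; (ii) the Hankel matrix $[f_{i+j+1}]_{i,j\ge 0}$ is TP$_r$.
   Context: A real matrix is TP$_r$ if all its minors of order $k\le r$ are nonnegative. For a set $\mathbf{x}$ of indeterminates, a matrix with entries in $\mathbb{R}[\mathbf{x}]$ is $\mathbf{x}$-TP$_r$ if all its minors of order $k\le r$ are polynomials with nonnegative coefficients in the indeterminates $\mathbf{x}$. A formal power series $\sum_{n\ge 0}a_nt^n\in\mathbb{R}[[t]]$ is a PF$_r$ function if its Toeplitz matrix $[a_{i-j}]_{i,j\ge 0}$ (with $a_m=0$ for $m<0$) is TP$_r$. $\bar f$ denotes the compositional inverse of $f$ and $\bar f'$ its derivative. The Sheffer polynomials $S_n(f,g;q)=\sum_{k=0}^nS_{n,k}(f,g)q^k$ are defined by $\sum_{n\ge 0}S_n(f,g;q)\frac{t^n}{n!}=g(t)\exp(qf(t))$, and $S_n^*(f,g;q)=q^nS_n(f,g;1/q)$. *)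

theory Defs
  imports
    "HOL-Computational_Algebra.Formal_Power_Series"
    "Jordan_Normal_Form.Determinant"
begin

section \<open>Total positivity of infinite matrices\<close>

text \<open>Matrices are indexed by \<^typ>\<open>nat\<close> on both sides. A minor of order \<open>k\<close> is given by
  row indices \<open>rs 0 < \<dots> < rs (k - 1)\<close> and column indices \<open>cs 0 < \<dots> < cs (k - 1)\<close>; the values
  of \<open>rs\<close> and \<open>cs\<close> at arguments \<open>\<ge> k\<close> are irrelevant.\<close>

definition minor :: "(nat \<Rightarrow> nat \<Rightarrow> 'a :: comm_ring_1) \<Rightarrow> nat \<Rightarrow> (nat \<Rightarrow> nat) \<Rightarrow> (nat \<Rightarrow> nat) \<Rightarrow> 'a" where
  "minor M k rs cs = det (mat k k (\<lambda>(a, b). M (rs a) (cs b)))"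

definition TP :: "nat \<Rightarrow> (nat \<Rightarrow> nat \<Rightarrow> real) \<Rightarrow> bool" where
  "TP r M \<longleftrightarrow> (\<forall>k\<le>r. \<forall>rs cs. strict_mono_on {..<k} rs \<longrightarrow> strict_mono_on {..<k} cs \<longrightarrow>
     0 \<le> minor M k rs cs)"

text \<open>The ring of polynomials in the two indeterminates \<open>\<lambda>\<close> and \<open>q\<close> is \<^typ>\<open>real poly poly\<close>,
  where \<open>q\<close> is the outer and \<open>\<lambda>\<close> the inner variable. The library order on \<^typ>\<open>real poly\<close> (sign
  of the leading coefficient) is not coefficientwise and is not used.\<close>

definition nonneg_coeffs :: "real poly poly \<Rightarrow> bool" where
  "nonneg_coeffs p \<longleftrightarrow> (\<forall>i j. 0 \<le> coeff (coeff p i) j)"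

definition poly_TP :: "nat \<Rightarrow> (nat \<Rightarrow> nat \<Rightarrow> real poly poly) \<Rightarrow> bool" where
  "poly_TP r M \<longleftrightarrow> (\<forall>k\<le>r. \<forall>rs cs. strict_mono_on {..<k} rs \<longrightarrow> strict_mono_on {..<k} cs \<longrightarrow>
     nonneg_coeffs (minor M k rs cs))"

definition toeplitz :: "'a :: zero fps \<Rightarrow> nat \<Rightarrow> nat \<Rightarrow> 'a" where
  "toeplitz a i j = (if j \<le> i then fps_nth a (i - j) else 0)"

definition hankel :: "(nat \<Rightarrow> 'a) \<Rightarrow> nat \<Rightarrow> nat \<Rightarrow> 'a" where
  "hankel a i j = a (i + j)"

definition PF :: "nat \<Rightarrow> real fps \<Rightarrow> bool" where
  "PF r a \<longleftrightarrow> TP r (toeplitz a)"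

section \<open>Sheffer polynomials\<close>

definition fps_map :: "('a \<Rightarrow> 'b) \<Rightarrow> 'a :: zero fps \<Rightarrow> 'b :: zero fps" where
  "fps_map h a = Abs_fps (\<lambda>n. h (fps_nth a n))"

text \<open>The exponential \<open>\<Sum>n. F ^ n / n!\<close> of a power series \<open>F\<close> without constant term. The ring of
  coefficients need not be a field; the embedding \<open>c\<close> of the reals into it interprets \<open>1 / n!\<close>.\<close>

definition exp_of :: "(real \<Rightarrow> 'a :: comm_ring_1) \<Rightarrow> 'a fps \<Rightarrow> 'a fps" where
  "exp_of c F = fps_compose (fps_map c (fps_exp 1)) F"

text \<open>\<open>exp (\<lambda> f(t))\<close> as a power series over \<open>\<real>[\<lambda>]\<close>, where \<^term>\<open>[:0, 1:] :: real poly\<close> is \<open>\<lambda>\<close>.\<close>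

definition exp_lambda :: "real fps \<Rightarrow> real poly fps" where
  "exp_lambda f = exp_of (\<lambda>x. [:x:]) (fps_const [:0, 1:] * fps_map (\<lambda>x. [:x:]) f)"

text \<open>\<open>exp (q f(t))\<close> as a power series over \<open>\<real>[\<lambda>][q]\<close>, where \<^term>\<open>[:0, 1:] :: real poly poly\<close>
  is \<open>q\<close>.\<close>

definition exp_q :: "real fps \<Rightarrow> real poly poly fps" where
  "exp_q f = exp_of (\<lambda>x. [:[:x:]:]) (fps_const [:0, 1:] * fps_map (\<lambda>x. [:[:x:]:]) f)"

definition sheffer_poly :: "real fps \<Rightarrow> real poly fps \<Rightarrow> nat \<Rightarrow> real poly poly" where
  "sheffer_poly f g n = fact n * fps_nth (fps_map (\<lambda>p. [:p:]) g * exp_q f) n"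

definition sheffer_coeff :: "real fps \<Rightarrow> real poly fps \<Rightarrow> nat \<Rightarrow> nat \<Rightarrow> real poly" where
  "sheffer_coeff f g n k = coeff (sheffer_poly f g n) k"

text \<open>\<open>q\<^sup>n S\<^sub>n(f,g;1/q) = \<Sum>k\<le>n. S\<^sub>n\<^sub>,\<^sub>k(f,g) q\<^sup>n\<^sup>-\<^sup>k\<close>. This is not \<^const>\<open>reflect_poly\<close>, which reverses
  with respect to the actual degree instead of \<open>n\<close>. See \<open>poly_sheffer_poly_star\<close> below.\<close>

definition sheffer_poly_star :: "real fps \<Rightarrow> real poly fps \<Rightarrow> nat \<Rightarrow> real poly poly" where
  "sheffer_poly_star f g n = (\<Sum>k\<le>n. monom (sheffer_coeff f g n k) (n - k))"

lemma degree_sheffer_poly: "degree (sheffer_poly f g n) \<le> n"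
proof -
  let ?F = "fps_map (\<lambda>x. [:[:x:]:]) f :: real poly poly fps"
  have const: "\<exists>c. fps_nth (?F ^ i) m = [:c:]" for i m
  proof (induction i arbitrary: m)
    case 0
    show ?case by (cases "m = 0") (auto simp: one_pCons intro: exI[of _ 1] exI[of _ 0])
  next
    case (Suc i)
    from Suc have "degree (fps_nth (?F ^ i) l) = 0" for l
      by (metis degree_pCons_0)
    then have "degree (fps_nth (?F ^ Suc i) m) \<le> 0"
      unfolding power_Suc fps_mult_nth
      by (intro degree_sum_le) (auto simp: fps_map_def intro!: order_trans[OF degree_mult_le])
    then show ?case by (metis degree_0_id le_zero_eq degree_eq_zeroE)
  qed
  have pow: "degree (fps_nth ((fps_const [:0, 1:] * ?F) ^ i) m) \<le> i" for i m
  proof -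
    obtain c where c: "fps_nth (?F ^ i) m = [:c:]" using const by blast
    have "fps_nth ((fps_const [:0, 1:] * ?F) ^ i) m = [:0, 1:] ^ i * [:c:]"
      by (simp add: power_mult_distrib fps_const_power c del: mult_pCons_right)
    also have "degree \<dots> \<le> i"
      by (rule order_trans[OF degree_mult_le]) (use degree_power_le[of "[:0, 1:] :: real poly poly" i] in simp)
    finally show ?thesis .
  qed
  have e: "degree (fps_nth (exp_q f) m) \<le> m" for m
  proof -
    let ?G = "fps_const [:0, 1:] * ?F"
    have "degree (fps_nth (fps_map (\<lambda>x. [:[:x:]:]) (fps_exp 1)) i * fps_nth (?G ^ i) m) \<le> m"
      if "i \<le> m" for i
      using order_trans[OF pow that, of m]
      by (intro order_trans[OF degree_mult_le]) (simp add: fps_map_def)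
    then show ?thesis
      unfolding exp_q_def exp_of_def fps_compose_nth by (intro degree_sum_le) auto
  qed
  have "degree (fps_nth (fps_map (\<lambda>p. [:p:]) g * exp_q f) n) \<le> n"
    unfolding fps_mult_nth
    by (intro degree_sum_le)
      (auto simp: fps_map_def intro!: order_trans[OF degree_mult_le] order_trans[OF e])
  moreover have "degree (fact n :: real poly poly) = 0"
    by (metis degree_of_nat of_nat_fact)
  ultimately show ?thesis
    unfolding sheffer_poly_def by (intro order_trans[OF degree_mult_le]) simp
qed

lemma poly_sheffer_poly_star:
  fixes x :: real
  assumes "x \<noteq> 0"
  shows "poly (sheffer_poly_star f g n) [:x:] = [:x:] ^ n * poly (sheffer_poly f g n) [:1 / x:]"
proof -
  let ?S = "sheffer_poly f g n"
  have inv: "[:x:] ^ n * [:1 / x:] ^ k = [:x:] ^ (n - k)" if "k \<le> n" for k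
  proof -
    have "[:x:] ^ n * [:1 / x:] ^ k = [:x:] ^ (n - k) * ([:x:] * [:1 / x:]) ^ k"
      using that by (simp only: power_mult_distrib mult.assoc[symmetric] power_add[symmetric]) simp
    also have "[:x:] * [:1 / x:] = 1" using assms by (simp add: one_pCons)
    finally show ?thesis by simp
  qed
  have "poly ?S [:1 / x:] = (\<Sum>k\<le>n. coeff ?S k * [:1 / x:] ^ k)"
    unfolding poly_altdef using degree_sheffer_poly[of f g n]
    by (intro sum.mono_neutral_left) (auto simp: coeff_eq_0)
  then have "[:x:] ^ n * poly ?S [:1 / x:] = (\<Sum>k\<le>n. coeff ?S k * ([:x:] ^ n * [:1 / x:] ^ k))"
    by (simp only: sum_distrib_left mult.left_commute)
  also have "\<dots> = (\<Sum>k\<le>n. coeff ?S k * [:x:] ^ (n - k))"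
    by (intro sum.cong refl) (simp only: inv atMost_iff)
  also have "\<dots> = poly (sheffer_poly_star f g n) [:x:]"
    unfolding sheffer_poly_star_def sheffer_coeff_def by (simp only: poly_sum poly_monom)
  finally show ?thesis by simp
qed

end

theory Submission
  imports Defs
begin

text \<open>Write \<open>\<phi> = 1 / (fps_inv f)'\<close>. Differentiating \<open>fps_inv f oo f = fps_X\<close> gives the autonomous equation
  \<open>f' = \<phi> oo f\<close> (\<open>fps_deriv_eq_compose\<close>). The generating function of the Sheffer polynomials is
  \<open>E = exp ((\<lambda> + q) f)\<close>, so with \<open>x = \<lambda> + q\<close> it satisfies \<open>E' = x f' E\<close>. Consider the exponential
  Riordan array \<open>O n k = n!/k! [t\<^sup>n] E f\<^sup>k\<close>, whose column \<open>0\<close> is the sequence of Sheffer polynomials.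
  Differentiating \<open>E f\<^sup>k\<close> and inserting the two differential equations expresses each row of \<open>O\<close>
  through the previous one: row \<open>n + 1\<close> is row \<open>n\<close> times the production matrix \<open>P = \<Phi> (x I + \<Delta>)\<close>, where
  \<open>\<Phi> j k = \<phi>\<^sub>j\<^sub>-\<^sub>k j!/k!\<close> and \<open>\<Delta>\<close> has ones just above the diagonal (\<open>exp_riordan_production\<close>).

  The matrix \<open>\<Phi>\<close> is the Toeplitz matrix of \<open>\<phi>\<close> with rows and columns rescaled by positive
  numbers, and the bidiagonal factor has minors that are \<open>0\<close> or powers of \<open>x\<close>. Hence, by Cauchy-Binet, all minors of
  \<open>P\<close> of order at most \<open>r\<close> have nonnegative coefficients. This passes from the production matrix to the Hankel
  matrix of column \<open>0\<close> (\<open>minors_in_hankel_production\<close>): \<open>O (n + m) 0\<close> counts weighted paths of \<open>n + m\<close> steps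
  from \<open>0\<close> to \<open>0\<close>, and splitting each path after \<open>n\<close> steps factors the Hankel matrix as \<open>O Q\<close>, where \<open>Q\<close>
  collects the weights of the returning halves; both factors arise by iterating \<open>P\<close> or its transpose.

  The reversed polynomials need no second production matrix: reversal turns each minor of one Hankel matrix into the reversal
  of the corresponding minor of the other (\<open>minor_hankel_reverse_upto\<close>). For the coefficients of \<open>f\<close> itself, take
  \<open>E = 1\<close> and \<open>x = 0\<close>. Then \<open>O\<close> has zero column \<open>0\<close> apart from its corner, and deleting row and column \<open>0\<close>
  leaves an array whose production matrix is \<open>\<Phi>\<close> without its first row and whose column \<open>0\<close> is
  the sequence of the numbers \<open>n! [t\<^sup>n] f\<close> for \<open>n \<ge> 1\<close>.\<close>

section \<open>Minors and the Cauchy-Binet formula\<close>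

lemma minor_Leibniz:
  "minor M k rs cs =
    (\<Sum>p | p permutes {0..<k}. signof p * (\<Prod>i = 0..<k. M (rs i) (cs (p i))))"
proof -
  have "minor M k rs cs = (\<Sum>p | p permutes {0..<k}. signof p *
    (\<Prod>i = 0..<k. mat k k (\<lambda>(a, b). M (rs a) (cs b)) $$ (i, p i)))"
    unfolding minor_def by (rule det_def') simp
  also have "\<dots> = (\<Sum>p | p permutes {0..<k}. signof p * (\<Prod>i = 0..<k. M (rs i) (cs (p i))))"
  proof (intro sum.cong refl arg_cong2[of _ _ _ _ "(*)"] prod.cong)
    fix p i assume "p \<in> {p. p permutes {0..<k}}" "i \<in> {0..<k}"
    then show "mat k k (\<lambda>(a, b). M (rs a) (cs b)) $$ (i, p i) = M (rs i) (cs (p i))"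
      using permutes_in_image[of p "{0..<k}" i] by auto
  qed
  finally show ?thesis .
qed

lemma minor_cong:
  assumes "\<And>i j. i < k \<Longrightarrow> j < k \<Longrightarrow> M (rs i) (cs j) = M' (rs' i) (cs' j)"
  shows "minor M k rs cs = minor M' k rs' cs'"
  unfolding minor_def using assms by (intro arg_cong[of _ _ det] eq_matI) auto

lemma minor_transpose: "minor (\<lambda>i j. M j i) k rs cs = minor M k cs rs"
proof -
  have "mat k k (\<lambda>(a, b). M (cs b) (rs a)) = transpose_mat (mat k k (\<lambda>(a, b). M (cs a) (rs b)))"
    by (intro eq_matI) auto
  then show ?thesis unfolding minor_def by (simp add: det_transpose[of _ k])
qed

lemma minor_0 [simp]: "minor M 0 rs cs = 1"
  unfolding minor_def by (simp add: det_dim_zero)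

lemma minor_zero_below_corner:
  assumes "\<And>i. 0 < i \<Longrightarrow> i \<le> k \<Longrightarrow> M (rs i) (cs 0) = 0"
  shows "minor M (Suc k) rs cs = M (rs 0) (cs 0) * minor M k (rs \<circ> Suc) (cs \<circ> Suc)"
proof -
  let ?A = "mat (Suc k) (Suc k) (\<lambda>(a, b). M (rs a) (cs b))"
  have "det ?A = (\<Sum>i<Suc k. ?A $$ (i, 0) * cofactor ?A i 0)"
    by (rule laplace_expansion_column[of _ "Suc k"]) auto
  also have "\<dots> = ?A $$ (0, 0) * cofactor ?A 0 0"
    using assms by (subst sum.lessThan_Suc_shift) (auto intro!: sum.neutral)
  also have "cofactor ?A 0 0 = minor M k (rs \<circ> Suc) (cs \<circ> Suc)"
    unfolding cofactor_def minor_def mat_delete_def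
    by (auto intro!: arg_cong[of _ _ det] eq_matI)
  finally show ?thesis unfolding minor_def by simp
qed

lemma minor_zero_right_of_corner:
  assumes "\<And>j. 0 < j \<Longrightarrow> j \<le> k \<Longrightarrow> M (rs 0) (cs j) = 0"
  shows "minor M (Suc k) rs cs = M (rs 0) (cs 0) * minor M k (rs \<circ> Suc) (cs \<circ> Suc)"
  using minor_zero_below_corner[of k "\<lambda>i j. M j i" cs rs] assms
  by (simp add: minor_transpose[of M])

text \<open>Each term of the Leibniz expansion meets every chosen row and every chosen column exactly once.\<close>

lemma minor_scale:
  "minor (\<lambda>i j. d i * M i j * e j) k rs cs =
    (\<Prod>i = 0..<k. d (rs i)) * (\<Prod>i = 0..<k. e (cs i)) * minor M k rs cs"
  unfolding minor_Leibniz sum_distrib_left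
proof (intro sum.cong refl)
  fix p assume "p \<in> {p. p permutes {0..<k}}"
  then have "(\<Prod>i = 0..<k. e (cs (p i))) = (\<Prod>i = 0..<k. e (cs i))"
    using prod.permute[of p "{0..<k}" "\<lambda>i. e (cs i)"] by (simp add: o_def)
  then show "signof p * (\<Prod>i = 0..<k. d (rs i) * M (rs i) (cs (p i)) * e (cs (p i))) =
    (\<Prod>i = 0..<k. d (rs i)) * (\<Prod>i = 0..<k. e (cs i)) *
      (signof p * (\<Prod>i = 0..<k. M (rs i) (cs (p i))))"
    by (simp add: prod.distrib mult_ac)
qed

lemma (in comm_ring_hom) minor_hom: "minor (\<lambda>i j. hom (M i j)) k rs cs = hom (minor M k rs cs)"
proof -
  have "mat k k (\<lambda>(a, b). hom (M (rs a) (cs b))) = map_mat hom (mat k k (\<lambda>(a, b). M (rs a) (cs b)))"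
    by (intro eq_matI) auto
  then show ?thesis unfolding minor_def by (simp add: hom_det)
qed

lemma minor_permute_rows:
  assumes "p permutes {0..<k}"
  shows "minor M k (rs \<circ> p) cs = signof p * minor M k rs cs"
proof -
  let ?A = "mat k k (\<lambda>(a, b). M (rs a) (cs b))"
  have "mat k k (\<lambda>(a, b). M ((rs \<circ> p) a) (cs b)) = mat k k (\<lambda>(a, b). ?A $$ (p a, b))"
    using permutes_in_image[OF assms] by (intro eq_matI) auto
  moreover have "det (mat k k (\<lambda>(a, b). ?A $$ (p a, b))) = signof p * det ?A"
    by (rule det_permute_rows[OF _ assms]) simp
  ultimately show ?thesis unfolding minor_def by (simp only:)
qed

lemma minor_repeated_row:
  assumes "\<not> inj_on rs {0..<k}"
  shows "minor M k rs cs = 0"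
proof -
  from assms obtain i j where "i < k" "j < k" "i \<noteq> j" "rs i = rs j"
    by (auto simp: inj_on_def)
  then show ?thesis
    unfolding minor_def by (intro det_identical_rows[of _ k i j]) (auto intro!: eq_vecI)
qed

lemma strict_mono_nth_sorted_list_of_set:
  fixes S :: "nat set"
  shows "strict_mono_on {..<card S} (\<lambda>i. sorted_list_of_set S ! i)"
  proof (rule strict_mono_onI)
  fix i j :: nat assume "i \<in> {..<card S}" "j \<in> {..<card S}" "i < j"
  then show "sorted_list_of_set S ! i < sorted_list_of_set S ! j"
    by (intro sorted_wrt_nth_less[OF strict_sorted_list_of_set]) simp_all
qed

text \<open>Expanding every entry of the product in the Leibniz formula gives a sum over all functions \<open>f\<close> from the \<open>k\<close> rows
  to the summation indices, with \<open>minor Y k f cs\<close> as a factor. This factor vanishes unless \<open>f\<close> is injective. The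
  injective functions are grouped by their image \<open>S\<close>; those with image \<open>S\<close> are the rearrangements of its increasing
  enumeration, and the signs of the rearrangements assemble the minor of \<open>X\<close>.\<close>

lemma Cauchy_Binet:
  assumes "\<And>a b. a < k \<Longrightarrow> b < k \<Longrightarrow> M (rs a) (cs b) = (\<Sum>l<N. X (rs a) l * Y l (cs b))"
  shows "minor M k rs cs = (\<Sum>S | S \<subseteq> {..<N} \<and> card S = k.
    minor X k rs (\<lambda>i. sorted_list_of_set S ! i) * minor Y k (\<lambda>i. sorted_list_of_set S ! i) cs)"
proof -
  let ?I = "{0..<k}" and ?F = "PiE {0..<k} (\<lambda>_. {..<N})"
  let ?P = "{p. p permutes {0..<k}}"
  let ?T = "\<lambda>f. (\<Prod>i\<in>?I. X (rs i) (f i)) * minor Y k f cs"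
  let ?e = "\<lambda>S i. sorted_list_of_set S ! i"
  have finF: "finite ?F" by (intro finite_PiE) auto
  have "minor M k rs cs = (\<Sum>p\<in>?P. signof p *
      (\<Prod>i\<in>?I. \<Sum>l<N. X (rs i) l * Y l (cs (p i))))"
    unfolding minor_Leibniz
  proof (intro sum.cong refl arg_cong2[of _ _ _ _ "(*)"] prod.cong assms)
    fix p i assume "p \<in> ?P" "i \<in> ?I"
    then show "i < k" "p i < k" using permutes_in_image[of p ?I i] by auto
  qed
  also have "\<dots> = (\<Sum>p\<in>?P. \<Sum>f\<in>?F. signof p *
      (\<Prod>i\<in>?I. X (rs i) (f i) * Y (f i) (cs (p i))))"
    by (simp add: prod_sum_PiE sum_distrib_left)
  also have "\<dots> = (\<Sum>f\<in>?F. ?T f)"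
    unfolding minor_Leibniz sum_distrib_left
    by (subst sum.swap) (simp add: prod.distrib mult_ac)
  also have "\<dots> = (\<Sum>f | f \<in> ?F \<and> inj_on f ?I. ?T f)"
    using finF by (intro sum.mono_neutral_right) (auto simp: minor_repeated_row)
  also have "\<dots> = (\<Sum>S | S \<subseteq> {..<N} \<and> card S = k.
      \<Sum>f | f \<in> {f. f \<in> ?F \<and> inj_on f ?I} \<and> f ` ?I = S. ?T f)"
  proof (intro sum.group[symmetric])
    show "finite {f. f \<in> ?F \<and> inj_on f ?I}" by (rule finite_subset[OF _ finF]) auto
  qed (auto simp: card_image PiE_iff)
  also have "\<dots> = (\<Sum>S | S \<subseteq> {..<N} \<and> card S = k. minor X k rs (?e S) * minor Y k (?e S) cs)"
  proof (intro sum.cong refl)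
    fix S assume "S \<in> {S. S \<subseteq> {..<N} \<and> card S = k}"
    then have S: "S \<subseteq> {..<N}" "card S = k" "finite S" by (auto intro: finite_subset)
    have e: "bij_betw (?e S) ?I S"
      using bij_betw_nth[of "sorted_list_of_set S" ?I S] S by (auto simp: atLeast0LessThan)
    \<comment> \<open>A function with image \<open>S\<close> corresponds to the permutation \<open>p\<close> for which it equals \<open>?e S \<circ> p\<close>.\<close>
    let ?inv = "\<lambda>f i. if i \<in> ?I then inv_into ?I (?e S) (f i) else i"
    have "(\<Sum>f | f \<in> {f. f \<in> ?F \<and> inj_on f ?I} \<and> f ` ?I = S. ?T f) =
        (\<Sum>p\<in>?P. ?T (restrict (?e S \<circ> p) ?I))"
    proof (rule sum.reindex_bij_witness[of _ "\<lambda>p. restrict (?e S \<circ> p) ?I" ?inv])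
      fix f assume f: "f \<in> {f. f \<in> {f. f \<in> ?F \<and> inj_on f ?I} \<and> f ` ?I = S}"
      then have fI: "bij_betw f ?I S" and ext: "f \<in> extensional ?I"
        by (auto simp: bij_betw_def PiE_iff)
      have inv: "bij_betw (inv_into ?I (?e S) \<circ> f) ?I ?I"
        by (rule bij_betw_trans[OF fI bij_betw_inv_into[OF e]])
      have "bij_betw (?inv f) ?I ?I"
        by (rule iffD1[OF bij_betw_cong inv]) simp
      then show "?inv f \<in> ?P" by (auto intro: bij_imp_permutes)
      show r: "restrict (?e S \<circ> ?inv f) ?I = f"
        using bij_betw_inv_into_right[OF e] bij_betwE[OF fI] ext
        by (intro extensionalityI[of _ ?I]) auto
      show "?T (restrict (?e S \<circ> ?inv f) ?I) = ?T f"
        unfolding r ..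
    next
      fix p assume p: "p \<in> ?P"
      then have pI: "bij_betw p ?I ?I" by (auto intro: permutes_imp_bij)
      have b: "bij_betw (restrict (?e S \<circ> p) ?I) ?I S"
        by (rule iffD1[OF bij_betw_cong bij_betw_trans[OF pI e]]) simp
      then show "restrict (?e S \<circ> p) ?I \<in> {f. f \<in> {f. f \<in> ?F \<and> inj_on f ?I} \<and> f ` ?I = S}"
        using S by (auto simp: bij_betw_def)
      show "?inv (restrict (?e S \<circ> p) ?I) = p"
        using p bij_betw_inv_into_left[OF e] permutes_in_image[of p ?I] 
        by (auto simp: fun_eq_iff permutes_def)
    qed
    also have "\<dots> = (\<Sum>p\<in>?P. signof p * (\<Prod>i\<in>?I. X (rs i) (?e S (p i)))) * minor Y k (?e S) cs"
      unfolding sum_distrib_right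
    proof (intro sum.cong refl)
      fix p assume p: "p \<in> ?P"
      have "minor Y k (restrict (?e S \<circ> p) ?I) cs = minor Y k (?e S \<circ> p) cs"
        by (intro minor_cong) auto
      then show "?T (restrict (?e S \<circ> p) ?I) =
          signof p * (\<Prod>i\<in>?I. X (rs i) (?e S (p i))) * minor Y k (?e S) cs"
        using p by (simp add: minor_permute_rows mult_ac)
    qed
    finally show "(\<Sum>f | f \<in> {f. f \<in> ?F \<and> inj_on f ?I} \<and> f ` ?I = S. ?T f) =
        minor X k rs (?e S) * minor Y k (?e S) cs"
      by (simp add: minor_Leibniz)
  qed
  finally show ?thesis .
qed

section \<open>Matrices whose small minors lie in a positive cone\<close>

text \<open>Nonnegative reals and polynomials with nonnegative coefficients are treated at once: all that matters about the set \<open>C\<close>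
  of admissible values of the minors is that it is closed under sums and products.\<close>

definition minors_in :: "'a :: comm_ring_1 set \<Rightarrow> nat \<Rightarrow> (nat \<Rightarrow> nat \<Rightarrow> 'a) \<Rightarrow> bool" where
  "minors_in C r M \<longleftrightarrow> (\<forall>k\<le>r. \<forall>rs cs. strict_mono_on {..<k} rs \<longrightarrow> strict_mono_on {..<k} cs \<longrightarrow>
     minor M k rs cs \<in> C)"

lemma minors_inI:
  assumes "\<And>k rs cs. k \<le> r \<Longrightarrow> strict_mono_on {..<k} rs \<Longrightarrow> strict_mono_on {..<k} cs \<Longrightarrow>
    minor M k rs cs \<in> C"
  shows "minors_in C r M"
  using assms unfolding minors_in_def by blast

lemma minors_inD:
  assumes "minors_in C r M" "k \<le> r" "strict_mono_on {..<k} rs" "strict_mono_on {..<k} cs"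
  shows "minor M k rs cs \<in> C"
  using assms unfolding minors_in_def by blast

lemma TP_iff_minors_in: "TP r M \<longleftrightarrow> minors_in {x. 0 \<le> x} r M"
  unfolding TP_def minors_in_def by simp

lemma poly_TP_iff_minors_in: "poly_TP r M \<longleftrightarrow> minors_in {p. nonneg_coeffs p} r M"
  unfolding poly_TP_def minors_in_def by simp

lemma minors_in_entry:
  assumes "minors_in C r M" "1 \<le> r"
  shows "M i j \<in> C"
proof -
  have "minor M 1 (\<lambda>_. i) (\<lambda>_. j) \<in> C"
    using assms by (rule minors_inD) (auto intro!: strict_mono_onI)
  then show ?thesis by (simp add: minor_Leibniz)
qed

lemma minors_in_transpose:
  assumes "minors_in C r M"
  shows "minors_in C r (\<lambda>i j. M j i)"
  unfolding minors_in_def minor_transpose[of M] using minors_inD[OF assms] by blast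

lemma minors_in_drop_row:
  assumes "minors_in C r M"
  shows "minors_in C r (\<lambda>i j. M (Suc i) j)"
proof (rule minors_inI)
  fix k :: nat and rs cs :: "nat \<Rightarrow> nat"
  assume k: "k \<le> r" "strict_mono_on {..<k} rs" "strict_mono_on {..<k} cs"
  have "minor M k (Suc \<circ> rs) cs \<in> C"
    using assms k by (intro minors_inD) (auto simp: strict_mono_on_def)
  then show "minor (\<lambda>i j. M (Suc i) j) k rs cs \<in> C"
    by (simp add: minor_def)
qed

lemma strict_mono_on_o_Suc:
  fixes rs :: "nat \<Rightarrow> nat"
  assumes "strict_mono_on {..<Suc k} rs"
  shows "strict_mono_on {..<k} (rs \<circ> Suc)"
  using assms by (auto simp: strict_mono_on_def)

text \<open>Products of infinite matrices are only formed when each entry is a finite sum. This is stated by requiring the entry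
  to equal all sufficiently long partial sums, so that the finitely many entries of a minor share a common length.\<close>

lemma eventually_eq_partial_sum:
  fixes h :: "nat \<Rightarrow> 'a :: comm_monoid_add"
  assumes "s = (\<Sum>l<n. h l)" "\<And>l. n \<le> l \<Longrightarrow> h l = 0"
  shows "\<forall>\<^sub>F N in sequentially. s = (\<Sum>l<N. h l)"
proof (rule eventually_sequentiallyI[of n])
  fix N assume "n \<le> N"
  then show "s = (\<Sum>l<N. h l)"
    unfolding assms(1) using assms(2) by (intro sum.mono_neutral_left) auto
qed

locale positive_cone =
  fixes C :: "'a :: comm_ring_1 set"
  assumes zero_closed: "0 \<in> C" and one_closed: "1 \<in> C"
    and add_closed: "x \<in> C \<Longrightarrow> y \<in> C \<Longrightarrow> x + y \<in> C"
    and mult_closed: "x \<in> C \<Longrightarrow> y \<in> C \<Longrightarrow> x * y \<in> C"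
begin

lemma sum_closed: "(\<And>i. i \<in> I \<Longrightarrow> h i \<in> C) \<Longrightarrow> sum h I \<in> C"
  by (induction I rule: infinite_finite_induct) (auto intro: zero_closed add_closed)

lemma prod_closed: "(\<And>i. i \<in> I \<Longrightarrow> h i \<in> C) \<Longrightarrow> prod h I \<in> C"
  by (induction I rule: infinite_finite_induct) (auto intro: one_closed mult_closed)

lemma minor_product_closed:
  assumes M: "\<And>a b. a < k \<Longrightarrow> b < k \<Longrightarrow>
      \<forall>\<^sub>F N in sequentially. M (rs a) (cs b) = (\<Sum>l<N. X (rs a) l * Y l (cs b))"
    and X: "\<And>ls. strict_mono_on {..<k} ls \<Longrightarrow> minor X k rs ls \<in> C"
    and Y: "\<And>ls. strict_mono_on {..<k} ls \<Longrightarrow> minor Y k ls cs \<in> C"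
  shows "minor M k rs cs \<in> C"
proof -
  have "\<forall>\<^sub>F N in sequentially. \<forall>a\<in>{..<k}. \<forall>b\<in>{..<k}.
      M (rs a) (cs b) = (\<Sum>l<N. X (rs a) l * Y l (cs b))"
    using M by (intro eventually_ball_finite ballI) auto
  then obtain N where N: "\<And>a b. a < k \<Longrightarrow> b < k \<Longrightarrow>
      M (rs a) (cs b) = (\<Sum>l<N. X (rs a) l * Y l (cs b))"
    using eventually_happens'[OF sequentially_bot] by blast
  let ?e = "\<lambda>S i. sorted_list_of_set S ! i"
  have "minor M k rs cs = (\<Sum>S | S \<subseteq> {..<N} \<and> card S = k. minor X k rs (?e S) * minor Y k (?e S) cs)"
    using N by (rule Cauchy_Binet)
  also have "\<dots> \<in> C"
  proof (rule sum_closed)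
    fix S assume "S \<in> {S. S \<subseteq> {..<N} \<and> card S = k}"
    then have "strict_mono_on {..<k} (?e S)"
      using strict_mono_nth_sorted_list_of_set[of S] by simp
    then show "minor X k rs (?e S) * minor Y k (?e S) cs \<in> C"
      by (intro mult_closed X Y)
  qed
  finally show ?thesis .
qed

lemma minors_in_product:
  assumes "minors_in C r X" "minors_in C r Y"
    and "\<And>i j. \<forall>\<^sub>F N in sequentially. M i j = (\<Sum>l<N. X i l * Y l j)"
  shows "minors_in C r M"
proof (rule minors_inI)
  fix k :: nat and rs cs :: "nat \<Rightarrow> nat"
  assume k: "k \<le> r" "strict_mono_on {..<k} rs" "strict_mono_on {..<k} cs"
  show "minor M k rs cs \<in> C"
    using minors_inD[OF assms(1) k(1,2)] minors_inD[OF assms(2) k(1) _ k(3)]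
    by (rule minor_product_closed[OF assms(3)])
qed

lemma minors_in_scale:
  assumes "minors_in C r M" "\<And>i. d i \<in> C" "\<And>j. e j \<in> C"
  shows "minors_in C r (\<lambda>i j. d i * M i j * e j)"
  unfolding minors_in_def minor_scale
  using minors_inD[OF assms(1)] by (intro allI impI mult_closed prod_closed assms(2,3)) blast

text \<open>Row \<open>i\<close> of the matrix is supported on the columns \<open>i\<close> and \<open>i + 1\<close>. Hence in any submatrix the first column has zeros below the
  corner if \<open>cs 0 \<le> rs 0\<close>, and otherwise the first row has zeros to the right of it. Either way the corner entry splits off, so a
  minor is a product of entries.\<close>

lemma minors_in_bidiagonal:
  assumes x: "x \<in> C"
  shows "minors_in C r (\<lambda>i j. if j = i then x else if j = Suc i then 1 else 0)"
    (is "minors_in C r ?B")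
proof (rule minors_inI)
  fix k :: nat and rs cs :: "nat \<Rightarrow> nat"
  assume "strict_mono_on {..<k} rs" "strict_mono_on {..<k} cs"
  then show "minor ?B k rs cs \<in> C"
  proof (induction k arbitrary: rs cs)
    case 0
    show ?case by (simp add: one_closed)
  next
    case (Suc k)
    note IH = Suc.IH[OF Suc.prems[THEN strict_mono_on_o_Suc]]
    have rs: "rs 0 < rs i" if "0 < i" "i \<le> k" for i
      using Suc.prems(1) that by (auto simp: strict_mono_on_def)
    have cs: "cs 0 < cs i" if "0 < i" "i \<le> k" for i
      using Suc.prems(2) that by (auto simp: strict_mono_on_def)
    have corner: "?B (rs 0) (cs 0) \<in> C"
      using x by (simp add: zero_closed one_closed)
    have "minor ?B (Suc k) rs cs = ?B (rs 0) (cs 0) * minor ?B k (rs \<circ> Suc) (cs \<circ> Suc)"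
    proof (cases "cs 0 \<le> rs 0")
      case True
      show ?thesis
      proof (rule minor_zero_below_corner)
        fix i assume "0 < i" "i \<le> k"
        with rs[of i] True show "?B (rs i) (cs 0) = 0" by simp
      qed
    next
      case False
      show ?thesis
      proof (rule minor_zero_right_of_corner)
        fix j assume "0 < j" "j \<le> k"
        with cs[of j] False show "?B (rs 0) (cs j) = 0" by simp
      qed
    qed
    also have "\<dots> \<in> C" using corner IH by (rule mult_closed)
    finally show ?case .
  qed
qed

text \<open>Induction on a bound for the row indices. If row \<open>0\<close> is not among the chosen rows, the submatrix is a product of a
  submatrix of \<open>A\<close> with all rows moved up by one and a submatrix of \<open>P\<close>. If it is, then row \<open>0\<close> of the
  submatrix vanishes outside the corner, so its corner entry \<open>a\<close> or \<open>0\<close> splits off and leaves a minor without row \<open>0\<close>.\<close>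

lemma minors_in_iterates:
  assumes A_0: "\<And>k. A 0 k = (if k = 0 then a else 0)" and a: "a \<in> C"
    and step: "\<And>n k. \<forall>\<^sub>F N in sequentially. A (Suc n) k = (\<Sum>l<N. A n l * P l k)"
    and P: "minors_in C r P"
  shows "minors_in C r A"
proof -
  have "minor A k rs cs \<in> C"
    if "k \<le> r" "strict_mono_on {..<k} rs" "strict_mono_on {..<k} cs" "\<And>i. i < k \<Longrightarrow> rs i < n"
    for n k rs cs
    using that
  proof (induction n arbitrary: k rs cs)
    case 0
    then have "k = 0" by auto
    then show ?case by (simp add: one_closed)
  next
    case (Suc n)
    have positive_rows: "minor A k rs cs \<in> C"
      if k: "k \<le> r" "strict_mono_on {..<k} rs" "strict_mono_on {..<k} cs"
        "\<And>i. i < k \<Longrightarrow> 0 < rs i \<and> rs i \<le> n" for k rs cs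
    proof -
      let ?rs = "\<lambda>i. rs i - 1"
      have mono: "strict_mono_on {..<k} ?rs"
      proof (rule strict_mono_onI)
        fix i j assume ij: "i \<in> {..<k}" "j \<in> {..<k}" "i < j"
        have "rs i < rs j" using k(2) ij by (rule strict_mono_onD)
        moreover have "0 < rs i" using k(4) ij by auto
        ultimately show "rs i - 1 < rs j - 1" by arith
      qed
      have "minor A k rs cs = minor (\<lambda>i. A (Suc i)) k ?rs cs"
        using k(4) by (intro minor_cong) simp
      also have "\<dots> \<in> C"
      proof (rule minor_product_closed[where X = A and Y = P])
        fix ls :: "nat \<Rightarrow> nat" assume ls: "strict_mono_on {..<k} ls"
        show "minor A k ?rs ls \<in> C"
          using k(1) mono ls
        proof (rule Suc.IH)
          fix i assume "i < k"
          with k(4)[of i] show "?rs i < n" by arith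
        qed
        show "minor P k ls cs \<in> C" using P k(1) ls k(3) by (rule minors_inD)
      qed (rule step)
      finally show ?thesis .
    qed
    show ?case
    proof (cases k)
      case 0
      then show ?thesis by (simp add: one_closed)
    next
      case k: (Suc k')
      have rs: "rs 0 < rs i" if "0 < i" "i < k" for i
        using Suc.prems(2) that k by (auto simp: strict_mono_on_def)
      have cs: "cs 0 < cs i" if "0 < i" "i < k" for i
        using Suc.prems(3) that k by (auto simp: strict_mono_on_def)
      show ?thesis
      proof (cases "rs 0 = 0")
        case True
        have "minor A k rs cs = A (rs 0) (cs 0) * minor A k' (rs \<circ> Suc) (cs \<circ> Suc)"
          unfolding k
        proof (rule minor_zero_right_of_corner)
          fix j assume "0 < j" "j \<le> k'"
          with cs[of j] k show "A (rs 0) (cs j) = 0" by (simp add: True A_0)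
        qed
        moreover have "minor A k' (rs \<circ> Suc) (cs \<circ> Suc) \<in> C"
        proof (rule positive_rows)
          fix i assume "i < k'"
          then show "0 < (rs \<circ> Suc) i \<and> (rs \<circ> Suc) i \<le> n"
            using rs[of "Suc i"] Suc.prems(4)[of "Suc i"] k by auto
        qed (use Suc.prems k in \<open>auto intro: strict_mono_on_o_Suc\<close>)
        ultimately show ?thesis
          using a by (auto simp: True A_0 intro: mult_closed zero_closed)
      next
        case False
        show ?thesis
        proof (rule positive_rows)
          fix i assume i: "i < k"
          then show "0 < rs i \<and> rs i \<le> n"
            using rs[of i] Suc.prems(4)[of i] False by (cases "i = 0") auto
        qed (use Suc.prems in auto)
      qed
    qed
  qed
  note bounded = this
  show ?thesis
  proof (rule minors_inI)
    fix k :: nat and rs cs :: "nat \<Rightarrow> nat"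
    assume k: "k \<le> r" "strict_mono_on {..<k} rs" "strict_mono_on {..<k} cs"
    show "minor A k rs cs \<in> C"
    proof (rule bounded[OF k])
      fix i assume "i < k"
      then show "rs i < Suc (Max (rs ` {..<k}))" by (auto simp: less_Suc_eq_le)
    qed
  qed
qed

end

section \<open>Production matrices and Hankel matrices\<close>

text \<open>The entry \<open>P j k\<close> is read as the weight of a step from height \<open>j\<close> to height \<open>k\<close>. If no step rises
  by more than one, the sum covers all first steps, and \<open>return_weights P m k\<close> is the total weight of the paths of
  \<open>m\<close> steps from height \<open>k\<close> to height \<open>0\<close>, that is, the entry in row \<open>k\<close> and column \<open>0\<close> of the \<open>m\<close>-th
  power of \<open>P\<close>.\<close>

primrec return_weights :: "(nat \<Rightarrow> nat \<Rightarrow> 'a :: comm_ring_1) \<Rightarrow> nat \<Rightarrow> nat \<Rightarrow> 'a" where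
  "return_weights P 0 k = (if k = 0 then 1 else 0)"
| "return_weights P (Suc m) k = (\<Sum>l\<le>Suc k. P k l * return_weights P m l)"

text \<open>Here \<open>A n k\<close> is \<open>a\<close> times the total weight of the paths of \<open>n\<close> steps from height \<open>0\<close> to \<open>k\<close>. Cutting a
  closed path of \<open>n + m\<close> steps after its first \<open>n\<close> steps gives
  \<open>A (n + m) 0 = (\<Sum>k. A n k * return_weights P m k)\<close>, which is a factorization of the Hankel matrix. The first factor
  iterates \<open>P\<close>, and the transpose of the second iterates the transpose of \<open>P\<close>, so both are covered by
  \<open>minors_in_iterates\<close>.\<close>

theorem (in positive_cone) minors_in_hankel_production:
  assumes A_0: "\<And>k. A 0 k = (if k = 0 then a else 0)" and a: "a \<in> C"
    and step: "\<And>n k. A (Suc n) k = (\<Sum>j\<le>n. A n j * P j k)"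
    and hessenberg: "\<And>j k. Suc j < k \<Longrightarrow> P j k = 0"
    and P: "minors_in C r P"
  shows "minors_in C r (hankel (\<lambda>n. A n 0))"
proof -
  let ?Q = "return_weights P"
  have lower: "A n k = 0" if "n < k" for n k
    using that
  proof (induction n arbitrary: k)
    case 0
    then show ?case by (simp add: A_0)
  next
    case (Suc n)
    then show ?case by (auto simp: step hessenberg intro!: sum.neutral)
  qed
  have A: "minors_in C r A"
  proof (rule minors_in_iterates[where A = A and P = P, OF A_0 a _ P])
    show "\<forall>\<^sub>F N in sequentially. A (Suc n) k = (\<Sum>l<N. A n l * P l k)" for n k
      by (rule eventually_eq_partial_sum[of _ _ "Suc n"])
        (simp_all add: step lower lessThan_Suc_atMost)
  qed
  have Q: "minors_in C r ?Q"
  proof (rule minors_in_iterates[where A = ?Q and P = "\<lambda>i j. P j i", OF _ one_closed _ minors_in_transpose[OF P]])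
    show "\<forall>\<^sub>F N in sequentially. ?Q (Suc n) k = (\<Sum>l<N. ?Q n l * P k l)" for n k
      by (rule eventually_eq_partial_sum[of _ _ "Suc (Suc k)"])
        (simp_all add: hessenberg lessThan_Suc_atMost mult.commute del: sum.lessThan_Suc)
  qed simp
  have split: "A (n + m) 0 = (\<Sum>k\<le>n. A n k * ?Q m k)" for n m
  proof (induction m arbitrary: n)
    case 0
    show ?case by (simp add: if_distrib[of "(*) _"] sum.delta cong: if_cong)
  next
    case (Suc m)
    have "A (n + Suc m) 0 = (\<Sum>k\<le>Suc n. A (Suc n) k * ?Q m k)"
      using Suc[of "Suc n"] by simp
    also have "\<dots> = (\<Sum>k\<le>Suc n. \<Sum>j\<le>n. A n j * P j k * ?Q m k)"
      by (simp only: step sum_distrib_right)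
    also have "\<dots> = (\<Sum>j\<le>n. \<Sum>k\<le>Suc n. A n j * P j k * ?Q m k)"
      by (rule sum.swap)
    also have "\<dots> = (\<Sum>j\<le>n. \<Sum>k\<le>Suc j. A n j * P j k * ?Q m k)"
      by (intro sum.cong refl sum.mono_neutral_right) (auto simp: hessenberg)
    also have "\<dots> = (\<Sum>j\<le>n. A n j * ?Q (Suc m) j)"
      by (simp add: sum_distrib_left mult.assoc del: sum.atMost_Suc)
    finally show ?case .
  qed
  show ?thesis
  proof (rule minors_in_product[OF A minors_in_transpose[OF Q]])
    show "\<forall>\<^sub>F N in sequentially. hankel (\<lambda>n. A n 0) i j = (\<Sum>l<N. A i l * ?Q j l)" for i j
      by (rule eventually_eq_partial_sum[of _ _ "Suc i"])
        (simp_all add: hankel_def split lower lessThan_Suc_atMost)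
  qed
qed

section \<open>Power series under ring homomorphisms\<close>

lemma fps_map_nth [simp]: "fps_nth (fps_map h a) n = h (fps_nth a n)"
  by (simp add: fps_map_def)

lemma fps_map_fps_map: "fps_map h (fps_map h' a) = fps_map (\<lambda>x. h (h' x)) a"
  by (simp add: fps_eq_iff)

context comm_ring_hom
begin

lemma fps_map_mult: "fps_map hom (a * b) = fps_map hom a * fps_map hom b"
  by (simp add: fps_eq_iff fps_mult_nth hom_distribs)

lemma fps_map_1: "fps_map hom 1 = 1"
  by (simp add: fps_eq_iff)

lemma fps_map_power: "fps_map hom (a ^ n) = fps_map hom a ^ n"
  by (induction n) (simp_all add: fps_map_1 fps_map_mult)

lemma fps_map_const: "fps_map hom (fps_const x) = fps_const (hom x)"
  by (simp add: fps_eq_iff)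

lemma fps_map_deriv: "fps_map hom (fps_deriv a) = fps_deriv (fps_map hom a)"
  by (simp add: fps_eq_iff hom_distribs del: of_nat_Suc)

lemma fps_map_compose: "fps_map hom (a oo b) = fps_map hom a oo fps_map hom b"
  by (simp add: fps_eq_iff fps_compose_nth hom_distribs flip: fps_map_power)

end

lemma comm_ring_hom_const: "comm_ring_hom (\<lambda>x :: 'a :: comm_ring_1. [:x:])"
  by unfold_locales (simp_all add: one_pCons)

lemma comm_ring_hom_const_const: "comm_ring_hom (\<lambda>x :: 'a :: comm_ring_1. [:[:x:]:])"
  by unfold_locales (simp_all add: one_pCons)

lemma fps_deriv_exp_of:
  fixes c :: "real \<Rightarrow> 'a :: idom"
  assumes "comm_ring_hom c" "fps_nth G 0 = 0"
  shows "fps_deriv (exp_of c G) = exp_of c G * fps_deriv G"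
proof -
  interpret comm_ring_hom c by fact
  show ?thesis
    unfolding exp_of_def fps_compose_deriv[OF assms(2)] fps_map_deriv[symmetric] by simp
qed

lemma exp_of_nth_0:
  assumes "comm_ring_hom c"
  shows "fps_nth (exp_of c G) 0 = 1"
proof -
  interpret comm_ring_hom c by fact
  show ?thesis by (simp add: exp_of_def)
qed

section \<open>Exponential Riordan arrays and their production matrices\<close>

text \<open>Differentiating \<open>fps_inv f oo f = fps_X\<close> gives \<open>((fps_inv f)' oo f) * f' = 1\<close>.\<close>

lemma fps_deriv_eq_compose:
  fixes f :: "'a :: field fps"
  assumes "fps_nth f 0 = 0" "fps_nth f 1 \<noteq> 0"
  shows "fps_deriv f = (1 / fps_deriv (fps_inv f)) oo f"
proof -
  let ?h = "fps_deriv (fps_inv f)"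
  have "fps_deriv (fps_inv f oo f) = 1"
    using assms by (simp add: fps_inv)
  then have eq: "(?h oo f) * fps_deriv f = 1"
    using assms by (simp add: fps_compose_deriv)
  then have "fps_nth ((?h oo f) * fps_deriv f) 0 = 1" by simp
  then have h0: "fps_nth ?h 0 \<noteq> 0" by auto
  have "fps_deriv f = inverse (?h oo f)"
    using fps_inverse_unique[OF eq] by simp
  also have "\<dots> = inverse ?h oo f"
    using h0 assms by (simp add: fps_inverse_compose)
  finally show ?thesis using h0 by (simp add: fps_divide_unit)
qed

lemma fps_mult_power_nth_eq_0:
  fixes F :: "'a :: comm_ring_1 fps"
  assumes "fps_nth F 0 = 0" "n < j"
  shows "fps_nth (E * F ^ j) n = 0"
  using assms startsby_zero_power_prefix[OF assms(1), of j]
  by (auto simp: fps_mult_nth intro!: sum.neutral)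

text \<open>Multiplication by \<open>a oo F = (\<Sum>l. a\<^sub>l F\<^sup>l)\<close> raises the exponent in \<open>E F\<^sup>k\<close> by \<open>l\<close> with weight \<open>a\<^sub>l\<close>,
  so it acts on the sequence of the \<open>E F\<^sup>j\<close> through the Toeplitz matrix of \<open>a\<close>.\<close>

lemma fps_compose_mult_power_nth:
  fixes F :: "'a :: comm_ring_1 fps"
  assumes F: "fps_nth F 0 = 0"
  shows "fps_nth ((a oo F) * (E * F ^ k)) n = (\<Sum>j\<le>n. toeplitz a j k * fps_nth (E * F ^ j) n)"
proof -
  have "fps_nth ((a oo F) * (E * F ^ k)) n =
      (\<Sum>i\<le>n. \<Sum>l\<le>n. fps_nth a l * (fps_nth (F ^ l) i * fps_nth (E * F ^ k) (n - i)))"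
    unfolding fps_mult_nth[of "a oo F"] fps_compose_nth atLeast0AtMost sum_distrib_right mult.assoc
    using startsby_zero_power_prefix[OF F]
    by (intro sum.cong refl sum.mono_neutral_left) auto
  also have "\<dots> = (\<Sum>l\<le>n. fps_nth a l * fps_nth (F ^ l * (E * F ^ k)) n)"
    by (subst sum.swap) (simp only: fps_mult_nth[of "F ^ _"] atLeast0AtMost sum_distrib_left)
  also have "\<dots> = (\<Sum>l\<in>{0..n}. toeplitz a (l + k) k * fps_nth (E * F ^ (l + k)) n)"
    by (simp add: toeplitz_def power_add mult_ac atLeast0AtMost)
  also have "\<dots> = (\<Sum>j\<in>{0 + k..n + k}. toeplitz a j k * fps_nth (E * F ^ j) n)"
    by (rule sum.shift_bounds_cl_nat_ivl[symmetric])
  also have "\<dots> = (\<Sum>j\<le>n + k. toeplitz a j k * fps_nth (E * F ^ j) n)"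
    by (rule sum.mono_neutral_left) (auto simp: toeplitz_def)
  also have "\<dots> = (\<Sum>j\<le>n. toeplitz a j k * fps_nth (E * F ^ j) n)"
    by (rule sum.mono_neutral_right) (auto simp: fps_mult_power_nth_eq_0[OF F])
  finally show ?thesis .
qed

text \<open>The column \<open>k\<close> has the exponential generating function \<open>E f\<^sup>k / k!\<close>. The coefficient ring of \<open>E\<close> need not be a
  field, so the embedding \<open>c\<close> of the reals interprets \<open>1 / k!\<close>.\<close>

definition exp_riordan :: "(real \<Rightarrow> 'a :: {comm_ring_1, semiring_char_0}) \<Rightarrow> 'a fps \<Rightarrow> real fps \<Rightarrow> nat \<Rightarrow> nat \<Rightarrow> 'a" where
  "exp_riordan c E f n k = fact n * c (1 / fact k) * fps_nth (E * fps_map c f ^ k) n"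

text \<open>With \<open>D\<close> denoting the derivative in \<open>y\<close>, row \<open>j\<close> lists the coefficients of the polynomial \<open>a(D) y\<^sup>j\<close>.\<close>

definition exp_toeplitz :: "real fps \<Rightarrow> nat \<Rightarrow> nat \<Rightarrow> real" where
  "exp_toeplitz a j k = fact j * toeplitz a j k * (1 / fact k)"

text \<open>With \<open>F\<close> for the image of \<open>f\<close>, \<open>E' = x F' E\<close> gives \<open>(E F\<^sup>k / k!)' = x F' E F\<^sup>k / k! + F' E F\<^sup>k\<^sup>-\<^sup>1 / (k - 1)!\<close>. Since
  \<open>F' = \<phi> oo F\<close>, each of the two terms is a combination of the columns \<open>E F\<^sup>j / j!\<close> with the coefficients of
  \<open>exp_toeplitz \<phi>\<close> in column \<open>k\<close> or \<open>k - 1\<close>.\<close>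

lemma exp_riordan_production:
  fixes c :: "real \<Rightarrow> 'a :: {idom, semiring_char_0}"
  assumes c: "comm_ring_hom c" and f0: "fps_nth f 0 = 0" and phi: "fps_deriv f = \<phi> oo f"
    and E: "fps_deriv E = fps_const x * fps_map c (fps_deriv f) * E"
  shows "exp_riordan c E f (Suc n) k = (\<Sum>j\<le>n. exp_riordan c E f n j *
    (x * c (exp_toeplitz \<phi> j k) + (if k = 0 then 0 else c (exp_toeplitz \<phi> j (k - 1)))))"
proof -
  interpret comm_ring_hom c by fact
  let ?F = "fps_map c f" and ?O = "exp_riordan c E f"
  have F0: "fps_nth ?F 0 = 0" by (simp add: f0)
  define D where "D i = fps_nth (fps_map c (fps_deriv f) * (E * ?F ^ i)) n" for i
  have D: "fact n * c (1 / fact i) * D i = (\<Sum>j\<le>n. ?O n j * c (exp_toeplitz \<phi> j i))" for i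
  proof -
    have *: "c (1 / fact j) * c (exp_toeplitz \<phi> j i) = c (1 / fact i) * c (toeplitz \<phi> j i)" for j
      by (simp add: exp_toeplitz_def flip: hom_mult)
    have "D i = (\<Sum>j\<le>n. toeplitz (fps_map c \<phi>) j i * fps_nth (E * ?F ^ j) n)"
      unfolding D_def phi fps_map_compose by (rule fps_compose_mult_power_nth[OF F0])
    also have "\<dots> = (\<Sum>j\<le>n. c (toeplitz \<phi> j i) * fps_nth (E * ?F ^ j) n)"
      by (intro sum.cong refl) (simp add: toeplitz_def)
    finally have D_sum: "D i = (\<Sum>j\<le>n. c (toeplitz \<phi> j i) * fps_nth (E * ?F ^ j) n)" .
    have "fact n * c (1 / fact i) * D i =
        (\<Sum>j\<le>n. fact n * (c (1 / fact i) * c (toeplitz \<phi> j i)) * fps_nth (E * ?F ^ j) n)"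
      unfolding D_sum sum_distrib_left by (simp only: mult.assoc)
    also have "\<dots> = (\<Sum>j\<le>n. ?O n j * c (exp_toeplitz \<phi> j i))"
      unfolding *[symmetric] exp_riordan_def by (simp only: mult_ac)
    finally show ?thesis .
  qed
  have "fps_deriv (E * ?F ^ k) = fps_const x * (fps_map c (fps_deriv f) * (E * ?F ^ k)) +
      fps_const (of_nat k) * (fps_map c (fps_deriv f) * (E * ?F ^ (k - 1)))"
    by (simp add: E fps_deriv_power fps_map_deriv algebra_simps)
  then have deriv: "fps_nth (fps_deriv (E * ?F ^ k)) n = x * D k + of_nat k * D (k - 1)"
    by (simp add: D_def)
  have "?O (Suc n) k = fact n * c (1 / fact k) * fps_nth (fps_deriv (E * ?F ^ k)) n"
    unfolding exp_riordan_def fps_deriv_nth by (simp add: algebra_simps)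
  also have "\<dots> = x * (fact n * c (1 / fact k) * D k) +
      fact n * (c (1 / fact k) * of_nat k) * D (k - 1)"
    unfolding deriv by (simp add: algebra_simps)
  also have "c (1 / fact k) * of_nat k = (if k = 0 then 0 else c (1 / fact (k - 1)))"
  proof (cases k)
    case (Suc k')
    have "c (1 / fact k) * of_nat k = c (1 / fact k * of_nat k)"
      by (simp only: hom_mult hom_of_nat)
    also have "1 / fact k * of_nat k = (1 / fact (k - 1) :: real)"
      by (simp add: Suc del: of_nat_Suc)
    finally show ?thesis by (simp add: Suc)
  qed simp
  finally show ?thesis
    using D[of k] D[of "k - 1"]
    by (cases "k = 0") (simp_all add: sum.distrib sum_distrib_left algebra_simps)
qed

lemma exp_riordan_0:
  assumes "comm_ring_hom c" "fps_nth f 0 = 0"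
  shows "exp_riordan c E f 0 k = (if k = 0 then fps_nth E 0 else 0)"
proof -
  interpret comm_ring_hom c by fact
  show ?thesis using assms(2) by (cases k) (simp_all add: exp_riordan_def fps_power_zeroth)
qed

section \<open>Positivity of the production matrix\<close>

lemma positive_cone_nonneg: "positive_cone {x :: real. 0 \<le> x}"
  by unfold_locales auto

lemma positive_cone_nonneg_coeffs: "positive_cone {p. nonneg_coeffs p}"
proof
  fix p q :: "real poly poly"
  assume "p \<in> {p. nonneg_coeffs p}" "q \<in> {p. nonneg_coeffs p}"
  then show "p * q \<in> {p. nonneg_coeffs p}"
    by (auto simp: nonneg_coeffs_def coeff_mult coeff_sum intro!: sum_nonneg)
qed (auto simp: nonneg_coeffs_def one_pCons coeff_pCons split: nat.split)

lemma minors_in_hom: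
  assumes "comm_ring_hom c" "minors_in D r M" "\<And>x. x \<in> D \<Longrightarrow> c x \<in> C"
  shows "minors_in C r (\<lambda>i j. c (M i j))"
proof -
  interpret comm_ring_hom c by fact
  show ?thesis
    using assms(2,3) unfolding minors_in_def minor_hom by blast
qed

lemma minors_in_exp_toeplitz:
  assumes "PF r a"
  shows "minors_in {x. 0 \<le> x} r (exp_toeplitz a)"
proof -
  interpret positive_cone "{x :: real. 0 \<le> x}" by (rule positive_cone_nonneg)
  have "minors_in {x. 0 \<le> x} r (toeplitz a)"
    using assms by (simp add: PF_def TP_iff_minors_in)
  then show ?thesis
    unfolding exp_toeplitz_def[abs_def] by (rule minors_in_scale) auto
qed

text \<open>The matrix is the product of \<open>M\<close> with the bidiagonal matrix that has \<open>x\<close> on the diagonal and \<open>1\<close> just above it.\<close>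

lemma (in positive_cone) minors_in_times_bidiagonal:
  assumes "minors_in C r M" "x \<in> C"
  shows "minors_in C r (\<lambda>j k. x * M j k + (if k = 0 then 0 else M j (k - 1)))"
proof (rule minors_in_product[OF assms(1) minors_in_bidiagonal[OF assms(2)]])
  fix j k
  show "\<forall>\<^sub>F N in sequentially. x * M j k + (if k = 0 then 0 else M j (k - 1)) =
      (\<Sum>l<N. M j l * (if k = l then x else if k = Suc l then 1 else 0))"
  proof (rule eventually_eq_partial_sum[of _ _ "Suc k"])
    show "x * M j k + (if k = 0 then 0 else M j (k - 1)) =
        (\<Sum>l<Suc k. M j l * (if k = l then x else if k = Suc l then 1 else 0))"
    proof (cases k)
      case (Suc k')
      have "(\<Sum>l<k'. M j l * (if k = l then x else if k = Suc l then 1 else 0)) = 0"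
        using Suc by (intro sum.neutral) auto
      then show ?thesis by (simp add: Suc)
    qed (simp add: mult.commute)
  qed auto
qed

section \<open>Reversal of polynomials\<close>

text \<open>This is \<open>y\<^sup>N p(1/y)\<close> for \<open>degree p \<le> N\<close>. The exponent \<open>N\<close> is prescribed instead of being the actual degree of \<open>p\<close>,
  which makes reversal additive.\<close>

definition reverse_upto :: "nat \<Rightarrow> 'a :: comm_monoid_add poly \<Rightarrow> 'a poly" where
  "reverse_upto N p = (\<Sum>k\<le>N. monom (coeff p k) (N - k))"

lemma coeff_reverse_upto: "coeff (reverse_upto N p) i = (if i \<le> N then coeff p (N - i) else 0)"
proof -
  have "coeff (reverse_upto N p) i = (\<Sum>k\<le>N. if N - k = i then coeff p k else 0)"
    by (simp add: reverse_upto_def coeff_sum)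
  also have "\<dots> = (\<Sum>k\<le>N. if k = N - i \<and> i \<le> N then coeff p k else 0)"
    by (intro sum.cong refl) auto
  finally show ?thesis by (simp add: sum.delta if_distrib cong: conj_cong)
qed

lemma reverse_upto_conv_reflect_poly:
  fixes p :: "'a :: comm_ring_1 poly"
  assumes "degree p \<le> N"
  shows "reverse_upto N p = monom 1 (N - degree p) * reflect_poly p"
proof (rule poly_eqI)
  fix i
  show "coeff (reverse_upto N p) i = coeff (monom 1 (N - degree p) * reflect_poly p) i"
    using assms
    by (auto simp: coeff_reverse_upto coeff_monom_mult coeff_reflect_poly coeff_eq_0
        intro: arg_cong[of _ _ "coeff p"])
qed

lemma reverse_upto_mult:
  fixes p q :: "'a :: idom poly"
  assumes "degree p \<le> M" "degree q \<le> N"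
  shows "reverse_upto (M + N) (p * q) = reverse_upto M p * reverse_upto N q"
proof (cases "p = 0 \<or> q = 0")
  case True
  then show ?thesis by (auto simp: reverse_upto_def)
next
  case False
  then have "degree (p * q) = degree p + degree q" by (simp add: degree_mult_eq)
  moreover have "(M - degree p) + (N - degree q) = M + N - (degree p + degree q)"
    using assms by arith
  then have "monom 1 (M - degree p) * monom 1 (N - degree q) =
      (monom 1 (M + N - (degree p + degree q)) :: 'a poly)"
    by (simp add: mult_monom)
  ultimately show ?thesis
    using assms by (simp add: reverse_upto_conv_reflect_poly reflect_poly_mult mult_ac)
qed

lemma reverse_upto_prod:
  fixes p :: "'b \<Rightarrow> 'a :: idom poly"
  assumes "\<And>i. i \<in> I \<Longrightarrow> degree (p i) \<le> N i"
  shows "reverse_upto (sum N I) (prod p I) = (\<Prod>i\<in>I. reverse_upto (N i) (p i)) \<and>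
    degree (prod p I) \<le> sum N I"
  using assms
proof (induction I rule: infinite_finite_induct)
  case (insert i I)
  then show ?case
    using reverse_upto_mult[of "p i" "N i" "prod p I" "sum N I"]
      degree_mult_le[of "p i" "prod p I"] by fastforce
qed (simp_all add: reverse_upto_def)

lemma reverse_upto_sum: "reverse_upto N (sum h I) = (\<Sum>i\<in>I. reverse_upto N (h i))"
  by (rule poly_eqI) (simp add: coeff_reverse_upto coeff_sum)

lemma reverse_upto_signof:
  "reverse_upto N (signof p * h) = signof p * reverse_upto N h"
  for h :: "'a :: comm_ring_1 poly"
  by (rule poly_eqI) (simp add: coeff_reverse_upto sign_def)

text \<open>The term of a permutation \<open>p\<close> in the Leibniz expansion is a product of polynomials \<open>a (rs i + cs (p i))\<close>, and the sum of
  these indices does not depend on \<open>p\<close>. So all terms are reversed with respect to the same exponent, and the reversals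
  add up to the reversal of the minor.\<close>

lemma minor_hankel_reverse_upto:
  fixes a :: "nat \<Rightarrow> 'a :: idom poly"
  assumes "\<And>n. degree (a n) \<le> n"
  shows "minor (hankel (\<lambda>n. reverse_upto n (a n))) k rs cs =
    reverse_upto ((\<Sum>i = 0..<k. rs i) + (\<Sum>i = 0..<k. cs i)) (minor (hankel a) k rs cs)"
  unfolding minor_Leibniz reverse_upto_sum reverse_upto_signof
proof (intro sum.cong refl arg_cong2[of _ _ _ _ "(*)"])
  fix p assume "p \<in> {p. p permutes {0..<k}}"
  then have "(\<Sum>i = 0..<k. cs (p i)) = (\<Sum>i = 0..<k. cs i)"
    using sum.permute[of p "{0..<k}" cs] by (simp add: o_def)
  then have "(\<Sum>i = 0..<k. rs i) + (\<Sum>i = 0..<k. cs i) = (\<Sum>i = 0..<k. rs i + cs (p i))"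
    by (simp add: sum.distrib)
  then show "(\<Prod>i = 0..<k. hankel (\<lambda>n. reverse_upto n (a n)) (rs i) (cs (p i))) =
      reverse_upto ((\<Sum>i = 0..<k. rs i) + (\<Sum>i = 0..<k. cs i)) (\<Prod>i = 0..<k. hankel a (rs i) (cs (p i)))"
    using reverse_upto_prod[of "{0..<k}" "\<lambda>i. a (rs i + cs (p i))" "\<lambda>i. rs i + cs (p i)"] assms
    by (simp add: hankel_def)
qed

section \<open>Hankel matrices of Sheffer polynomials\<close>

lemma fps_map_exp_lambda:
  "fps_map (\<lambda>p. [:p:]) (exp_lambda f) =
    exp_of (\<lambda>x. [:[:x:]:]) (fps_const [:[:0, 1:]:] * fps_map (\<lambda>x. [:[:x:]:]) f)"
proof -
  interpret comm_ring_hom "\<lambda>p :: real poly. [:p:]" by (rule comm_ring_hom_const)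
  show ?thesis
    by (simp add: exp_lambda_def exp_of_def fps_map_compose fps_map_mult fps_map_const fps_map_fps_map)
qed

lemma sheffer_poly_conv_exp_riordan:
  "sheffer_poly f g n =
    exp_riordan (\<lambda>x. [:[:x:]:]) (fps_map (\<lambda>p. [:p:]) g * exp_q f) f n 0"
  by (simp add: sheffer_poly_def exp_riordan_def one_pCons[symmetric])

lemma sheffer_poly_star_conv_reverse_upto:
  "sheffer_poly_star f g = (\<lambda>n. reverse_upto n (sheffer_poly f g n))"
  by (simp add: fun_eq_iff sheffer_poly_star_def sheffer_coeff_def reverse_upto_def)

lemma nonneg_coeffs_reverse_upto:
  "nonneg_coeffs p \<Longrightarrow> nonneg_coeffs (reverse_upto N p)"
  by (simp add: nonneg_coeffs_def coeff_reverse_upto)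

theorem poly_TP_hankel_sheffer_poly:
  assumes f0: "fps_nth f 0 = 0" and phi: "fps_deriv f = \<phi> oo f" and PF: "PF r \<phi>"
  shows "poly_TP r (hankel (sheffer_poly f (exp_lambda f)))"
proof -
  interpret positive_cone "{p. nonneg_coeffs p}" by (rule positive_cone_nonneg_coeffs)
  let ?c = "\<lambda>x :: real. [:[:x:]:]"
  let ?l = "[:[:0, 1:]:] :: real poly poly" and ?q = "[:0, 1:] :: real poly poly"
  define E where "E = fps_map (\<lambda>p. [:p:]) (exp_lambda f) * exp_q f"
  have c: "comm_ring_hom ?c" by (rule comm_ring_hom_const_const)
  then interpret c: comm_ring_hom ?c .
  have "fps_deriv E = fps_const ?l * fps_map ?c (fps_deriv f) * E +
      fps_const ?q * fps_map ?c (fps_deriv f) * E"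
    unfolding E_def fps_map_exp_lambda exp_q_def
    by (simp add: fps_deriv_exp_of[OF c] f0 c.fps_map_deriv algebra_simps)
  also have "\<dots> = fps_const (?l + ?q) * fps_map ?c (fps_deriv f) * E"
    by (simp only: fps_const_add[symmetric] distrib_right)
  finally have E_deriv: "fps_deriv E = fps_const (?l + ?q) * fps_map ?c (fps_deriv f) * E" .
  have E_0: "fps_nth E 0 = 1"
    by (simp add: E_def fps_map_exp_lambda exp_q_def exp_of_nth_0[OF c] del: fps_map_nth)
  let ?P = "\<lambda>j k. (?l + ?q) * ?c (exp_toeplitz \<phi> j k) +
    (if k = 0 then 0 else ?c (exp_toeplitz \<phi> j (k - 1)))"
  have "minors_in {p. nonneg_coeffs p} r (hankel (\<lambda>n. exp_riordan ?c E f n 0))"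
  proof (rule minors_in_hankel_production[where P = ?P and a = 1])
    show "exp_riordan ?c E f 0 k = (if k = 0 then 1 else 0)" for k
      using exp_riordan_0[OF c f0] E_0 by simp
    show "exp_riordan ?c E f (Suc n) k = (\<Sum>j\<le>n. exp_riordan ?c E f n j * ?P j k)" for n k
      by (rule exp_riordan_production[OF c f0 phi E_deriv])
    show "?P j k = 0" if "Suc j < k" for j k
      using that by (simp add: exp_toeplitz_def toeplitz_def)
    have "minors_in {p. nonneg_coeffs p} r (\<lambda>j k. ?c (exp_toeplitz \<phi> j k))"
      by (rule minors_in_hom[OF c minors_in_exp_toeplitz[OF PF]])
        (auto simp: nonneg_coeffs_def coeff_pCons split: nat.split)
    then show "minors_in {p. nonneg_coeffs p} r ?P"
      by (rule minors_in_times_bidiagonal)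
        (auto simp: nonneg_coeffs_def coeff_pCons split: nat.split)
  qed (rule one_closed)
  then show ?thesis
    by (simp add: poly_TP_iff_minors_in sheffer_poly_conv_exp_riordan[abs_def] E_def)
qed

theorem poly_TP_hankel_sheffer_poly_star:
  assumes "poly_TP r (hankel (sheffer_poly f g))"
  shows "poly_TP r (hankel (sheffer_poly_star f g))"
  using assms
  unfolding poly_TP_def sheffer_poly_star_conv_reverse_upto
    minor_hankel_reverse_upto[OF degree_sheffer_poly]
  by (blast intro: nonneg_coeffs_reverse_upto)

text \<open>For \<open>E = 1\<close> the array \<open>O n k = n!/k! [t\<^sup>n] f\<^sup>k\<close> has the entries \<open>n! [t\<^sup>n] f\<close> in column \<open>1\<close>. Column \<open>0\<close>
  is zero below the corner, so after removal of row \<open>0\<close> and column \<open>0\<close> each row still determines the next, now through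
  \<open>exp_toeplitz \<phi>\<close> without its row \<open>0\<close>. The corner entry of the remaining array is \<open>\<phi>\<^sub>0\<close>, a minor of order
  one of the Toeplitz matrix; this is where \<open>r \<ge> 1\<close> enters.\<close>

theorem TP_hankel_shifted_egf_coeffs:
  assumes f0: "fps_nth f 0 = 0" and phi: "fps_deriv f = \<phi> oo f" and PF: "PF r \<phi>" and r: "1 \<le> r"
  shows "TP r (hankel (\<lambda>n. fact (n + 1) * fps_nth f (n + 1)))"
proof -
  interpret positive_cone "{x :: real. 0 \<le> x}" by (rule positive_cone_nonneg)
  have c: "comm_ring_hom (\<lambda>x :: real. x)" by unfold_locales auto
  let ?O = "exp_riordan (\<lambda>x. x) 1 f" and ?P = "\<lambda>j k. exp_toeplitz \<phi> (Suc j) k"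
  have O: "?O (Suc n) (Suc k) = (\<Sum>j\<le>n. ?O n j * exp_toeplitz \<phi> j k)" for n k
    using exp_riordan_production[OF c f0 phi, of 1 0 n "Suc k"] by simp
  have "minors_in {x. 0 \<le> x} r (hankel (\<lambda>n. ?O (Suc n) (Suc 0)))"
  proof (rule minors_in_hankel_production[where A = "\<lambda>n k. ?O (Suc n) (Suc k)" and P = ?P and a = "fps_nth \<phi> 0"])
    show "?O (Suc 0) (Suc k) = (if k = 0 then fps_nth \<phi> 0 else 0)" for k
      using exp_riordan_0[OF c f0] by (simp add: O exp_toeplitz_def toeplitz_def)
    have "0 \<le> toeplitz \<phi> 0 0"
      using minors_in_entry[of _ r "toeplitz \<phi>"] PF r by (auto simp: PF_def TP_iff_minors_in)
    then show "fps_nth \<phi> 0 \<in> {x. 0 \<le> x}" by (simp add: toeplitz_def)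
    have "?O (Suc n) 0 = 0" for n by (simp add: exp_riordan_def)
    then show "?O (Suc (Suc n)) (Suc k) = (\<Sum>j\<le>n. ?O (Suc n) (Suc j) * ?P j k)" for n k
      unfolding O[of "Suc n"] by (subst sum.atMost_Suc_shift) simp
    show "?P j k = 0" if "Suc j < k" for j k
      using that by (simp add: exp_toeplitz_def toeplitz_def)
    show "minors_in {x. 0 \<le> x} r ?P"
      by (rule minors_in_drop_row[OF minors_in_exp_toeplitz[OF PF]])
  qed
  moreover have "?O (Suc n) (Suc 0) = fact (n + 1) * fps_nth f (n + 1)" for n
    by (simp add: exp_riordan_def fps_map_def fps_nth_inverse)
  ultimately show ?thesis by (simp add: TP_iff_minors_in)
qed

theorem theorem1p3:
  fixes f :: "real fps" and g :: "real poly fps" and r :: nat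
  assumes "fps_nth f 0 = 0" and "fps_nth f 1 \<noteq> 0"
    and "g = exp_lambda f"
    and "r \<ge> 1"
    and "PF r (1 / fps_deriv (fps_inv f))"
  shows "poly_TP r (hankel (sheffer_poly f g)) \<and>
    poly_TP r (hankel (sheffer_poly_star f g)) \<and>
    TP r (hankel (\<lambda>n. fact (n + 1) * fps_nth f (n + 1)))"
proof -
  note phi = fps_deriv_eq_compose[OF assms(1,2)]
  have "poly_TP r (hankel (sheffer_poly f g))"
    unfolding assms(3) by (rule poly_TP_hankel_sheffer_poly[OF assms(1) phi assms(5)])
  moreover from this have "poly_TP r (hankel (sheffer_poly_star f g))"
    by (rule poly_TP_hankel_sheffer_poly_star)
  moreover have "TP r (hankel (\<lambda>n. fact (n + 1) * fps_nth f (n + 1)))"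
    by (rule TP_hankel_shifted_egf_coeffs[OF assms(1) phi assms(5,4)])
  ultimately show ?thesis by blast
qed

end
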